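(* Let $0\to\mathfrak{h}_Q\xrightarrow{i}\mathfrak{e}_U\xrightarrow{p}\mathfrak{g}_P\to0$ be a non-abelian extension of averaging Lie algebras. Then there is an exact sequence $$1\to\mathrm{Aut}_{\mathfrak{h}}^{\mathfrak{h},\mathfrak{g}}(\mathfrak{e}_U)\xrightarrow{\iota}\mathrm{Aut}_{\mathfrak{h}}(\mathfrak{e}_U)\xrightarrow{\Pi}\mathrm{Aut}(\mathfrak{h}_Q)\times\mathrm{Aut}(\mathfrak{g}_P)\xrightarrow{\mathcal{W}}H^2_{\mathrm{nab}}(\mathfrak{g}_P,\mathfrak{h}_Q),$$ where $\iota$ is the inclusion, and exactness at $\mathrm{Aut}(\mathfrak{h}_Q)\times\mathrm{Aut}(\mathfrak{g}_P)$ means $\mathrm{Im}(\Pi)=\{(\beta,\alpha):\mathcal{W}((\beta,\alpha))=0\}$.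
   Context: Everything is over a field of characteristic zero. An averaging operator on a Lie algebra $\mathfrak{g}$ is a linear map $P:\mathfrak{g}\to\mathfrak{g}$ with $[P(x),P(y)]_{\mathfrak{g}}=P([P(x),y]_{\mathfrak{g}})$ for all $x,y$; an averaging Lie algebra $\mathfrak{g}_P$ is a Lie algebra $\mathfrak{g}$ with an averaging operator $P$. A morphism $\mathfrak{g}_P\to\mathfrak{g}'_{P'}$ is a Lie algebra homomorphism $\tau$ with $P'\circ\tau=\tau\circ P$; $\mathrm{Aut}(\mathfrak{g}_P)$ is the group of bijective morphisms $\mathfrak{g}_P\to\mathfrak{g}_P$. A non-abelian extension of $\mathfrak{g}_P$ by $\mathfrak{h}_Q$ is an averaging Lie algebra $\mathfrak{e}_U$ with a short exact sequence $0\to\mathfrak{h}_Q\xrightarrow{i}\mathfrak{e}_U\xrightarrow{p}\mathfrak{g}_P\to0$ of averaging Lie algebras ($i,p$ morphisms); $\mathfrak{h}$ is identified with $i(\mathfrak{h})\subset\mathfrak{e}$. A section is a linear map $s:\mathfrak{g}\to\mathfrak{e}$ with $p\circ s=\mathrm{Id}_{\mathfrak{g}}$. The corresponding non-abelian $2$-cocycle is the triple $\chi(x,y)=[s(x),s(y)]_{\mathfrak{e}}-s[x,y]_{\mathfrak{g}}$, $\psi_x(h)=[s(x),h]_{\mathfrak{e}}$, $\Phi(x)=U(s(x))-s(P(x))$. $\mathrm{Aut}_{\mathfrak{h}}(\mathfrak{e}_U)$ is the group of $\gamma\in\mathrm{Aut}(\mathfrak{e}_U)$ with $\gamma(\mathfrak{h})=\mathfrak{h}$.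 For such $\gamma$ put $\overline{\gamma}:=p\gamma s$ (independent of $s$); the group homomorphism $\Pi:\mathrm{Aut}_{\mathfrak{h}}(\mathfrak{e}_U)\to\mathrm{Aut}(\mathfrak{h}_Q)\times\mathrm{Aut}(\mathfrak{g}_P)$ is $\Pi(\gamma)=(\gamma|_{\mathfrak{h}},\overline{\gamma})$. The subgroup $\mathrm{Aut}_{\mathfrak{h}}^{\mathfrak{h},\mathfrak{g}}(\mathfrak{e}_U)$ is $\{\gamma\in\mathrm{Aut}_{\mathfrak{h}}(\mathfrak{e}_U):\Pi(\gamma)=(\mathrm{Id}_{\mathfrak{h}},\mathrm{Id}_{\mathfrak{g}})\}$. In general, a non-abelian $2$-cocycle of $\mathfrak{g}_P$ with values in $\mathfrak{h}_Q$ is a triple $(\chi,\psi,\Phi)$ of linear maps $\chi:\wedge^2\mathfrak{g}\to\mathfrak{h}$, $\psi:\mathfrak{g}\to\mathrm{Der}(\mathfrak{h})$, $\Phi:\mathfrak{g}\to\mathfrak{h}$ such that for all $x,y,z\in\mathfrak{g}$, $h\in\mathfrak{h}$: (a) $\psi_x\psi_y(h)-\psi_y\psi_x(h)-\psi_{[x,y]_{\mathfrak{g}}}(h)=[\chi(x,y),h]_{\mathfrak{h}}$; (b) $\psi_x\chi(y,z)+\psi_y\chi(z,x)+\psi_z\chi(x,y)-\chi([x,y]_{\mathfrak{g}},z)-\chi([y,z]_{\mathfrak{g}},x)-\chi([z,x]_{\mathfrak{g}},y)=0$; (c) $\psi_{P(x)}Q(h)=Q(\psi_{P(x)}h)+Q[\Phi(x),h]_{\mathfrak{h}}-[\Phi(x),Q(h)]_{\mathfrak{h}}=Q(\psi_xQ(h))-[\Phi(x),Q(h)]_{\mathfrak{h}}$;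 (d) $\chi(P(x),P(y))-Q(\chi(P(x),y))-\Phi[P(x),y]_{\mathfrak{g}}+\psi_{P(x)}\Phi(y)-\psi_{P(y)}\Phi(x)+Q(\psi_y\Phi(x))+[\Phi(x),\Phi(y)]_{\mathfrak{h}}=0$. Non-abelian $2$-cocycles $(\chi,\psi,\Phi)$ and $(\chi',\psi',\Phi')$ are equivalent if there is a linear map $\phi:\mathfrak{g}\to\mathfrak{h}$ such that for all $x,y\in\mathfrak{g}$, $h\in\mathfrak{h}$: $\psi_xh-\psi'_xh=[\phi(x),h]_{\mathfrak{h}}$; $\chi(x,y)-\chi'(x,y)=\psi'_x\phi(y)-\psi'_y\phi(x)-\phi[x,y]_{\mathfrak{g}}+[\phi(x),\phi(y)]_{\mathfrak{h}}$; $\Phi(x)-\Phi'(x)=Q\phi(x)-\phi P(x)$. $H^2_{\mathrm{nab}}(\mathfrak{g}_P,\mathfrak{h}_Q)$ is the set of equivalence classes. Fix a section $s$ with cocycle $(\chi,\psi,\Phi)$. For $(\beta,\alpha)\in\mathrm{Aut}(\mathfrak{h}_Q)\times\mathrm{Aut}(\mathfrak{g}_P)$ the non-abelian $2$-cocycle $(\chi_{(\beta,\alpha)},\psi_{(\beta,\alpha)},\Phi_{(\beta,\alpha)})$ is defined by $\chi_{(\beta,\alpha)}(x,y)=\beta\chi(\alpha^{-1}(x),\alpha^{-1}(y))$, $(\psi_{(\beta,\alpha)})_xh=\beta(\psi_{\alpha^{-1}(x)}\beta^{-1}(h))$, $\Phi_{(\beta,\alpha)}(x)=\beta\Phi(\alpha^{-1}(x))$.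 The Wells map is denoted $\mathcal{W}((\beta,\alpha))=[(\chi_{(\beta,\alpha)},\psi_{(\beta,\alpha)},\Phi_{(\beta,\alpha)})-(\chi,\psi,\Phi)]$; "$\mathcal{W}((\beta,\alpha))=0$" means that the non-abelian $2$-cocycles $(\chi_{(\beta,\alpha)},\psi_{(\beta,\alpha)},\Phi_{(\beta,\alpha)})$ and $(\chi,\psi,\Phi)$ are equivalent. *)

theory Defs
  imports Complex_Main "HOL-Algebra.Coset"
begin

text \<open>
  Vector spaces over \<open>'k\<close> are whole types \<open>'a :: ab_group_add\<close> equipped with a scalar
  multiplication.  The record bundles a scalar multiplication, a bracket and an operator.
\<close>

record ('k, 'a) avg_lie =
  scal :: "'k \<Rightarrow> 'a \<Rightarrow> 'a"
  lie :: "'a \<Rightarrow> 'a \<Rightarrow> 'a"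
  oper :: "'a \<Rightarrow> 'a"

abbreviation lin ::
    "('k :: field, 'a :: ab_group_add) avg_lie \<Rightarrow> ('k, 'b :: ab_group_add) avg_lie \<Rightarrow> ('a \<Rightarrow> 'b) \<Rightarrow> bool"
  where "lin A B f \<equiv> Vector_Spaces.linear (scal A) (scal B) f"

locale lie_algebra = vector_space "scal L"
  for L :: "('k :: field_char_0, 'a :: ab_group_add) avg_lie" +
  assumes lie_linear_left: "lin L L (\<lambda>x. lie L x y)"
    and lie_linear_right: "lin L L (\<lambda>y. lie L x y)"
    and lie_alternating: "lie L x x = 0"
    and lie_jacobi: "lie L x (lie L y z) + lie L y (lie L z x) + lie L z (lie L x y) = 0"

locale averaging_lie_algebra = lie_algebra L
  for L :: "('k :: field_char_0, 'a :: ab_group_add) avg_lie" +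
  assumes oper_linear: "lin L L (oper L)"
    and oper_averaging: "lie L (oper L x) (oper L y) = oper L (lie L (oper L x) y)"

definition averaging_hom ::
    "('k :: field_char_0, 'a :: ab_group_add) avg_lie \<Rightarrow> ('k, 'b :: ab_group_add) avg_lie \<Rightarrow> ('a \<Rightarrow> 'b) \<Rightarrow> bool"
  where "averaging_hom A B f \<longleftrightarrow> lin A B f
    \<and> (\<forall>x y. f (lie A x y) = lie B (f x) (f y))
    \<and> (\<forall>x. oper B (f x) = f (oper A x))"

definition Aut :: "('k :: field_char_0, 'a :: ab_group_add) avg_lie \<Rightarrow> ('a \<Rightarrow> 'a) monoid"
  where "Aut L = \<lparr>carrier = {f. averaging_hom L L f \<and> bij f}, mult = (\<circ>), one = id\<rparr>"

text \<open>
  Throughout, \<open>H\<close>, \<open>E\<close>, \<open>G\<close> stand for the averaging Lie algebras \<open>\<hh>\<^sub>Q\<close>, \<open>\<ee>\<^sub>U\<close>, \<open>\<gg>\<^sub>P\<close>.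
\<close>

locale nonabelian_extension =
    H: averaging_lie_algebra H + E: averaging_lie_algebra E + G: averaging_lie_algebra G
  for H :: "('k :: field_char_0, 'h :: ab_group_add) avg_lie"
    and E :: "('k, 'e :: ab_group_add) avg_lie"
    and G :: "('k, 'g :: ab_group_add) avg_lie"
    and i :: "'h \<Rightarrow> 'e" and p :: "'e \<Rightarrow> 'g" +
  assumes i_hom: "averaging_hom H E i"
    and p_hom: "averaging_hom E G p"
    and i_inj: "inj i"
    and exact: "range i = {e. p e = 0}"
    and p_surj: "surj p"

definition linear_section ::
    "('k :: field_char_0, 'e :: ab_group_add) avg_lie \<Rightarrow> ('k, 'g :: ab_group_add) avg_lie
      \<Rightarrow> ('e \<Rightarrow> 'g) \<Rightarrow> ('g \<Rightarrow> 'e) \<Rightarrow> bool"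
  where "linear_section E G p s \<longleftrightarrow> lin G E s \<and> p \<circ> s = id"

text \<open>Triples \<open>(\<chi>, \<psi>, \<Phi>)\<close>; here \<open>\<psi> x\<close> is the endomorphism \<open>\<psi>\<^sub>x\<close> of \<open>\<hh>\<close>.\<close>

type_synonym ('g, 'h) triple = "('g \<Rightarrow> 'g \<Rightarrow> 'h) \<times> ('g \<Rightarrow> 'h \<Rightarrow> 'h) \<times> ('g \<Rightarrow> 'h)"

definition derivation :: "('k :: field_char_0, 'h :: ab_group_add) avg_lie \<Rightarrow> ('h \<Rightarrow> 'h) \<Rightarrow> bool"
  where "derivation H d \<longleftrightarrow> lin H H d \<and> (\<forall>h k. d (lie H h k) = lie H (d h) k + lie H h (d k))"

text \<open>
  A linear map on \<open>\<wedge>\<^sup>2\<gg>\<close> is encoded as an alternating bilinear map on \<open>\<gg>\<close>; linearity of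
  \<open>\<psi> : \<gg> \<rightarrow> Der(\<hh>)\<close> is pointwise linearity of \<open>x \<mapsto> \<psi> x h\<close>.
\<close>

definition nab_cocycle ::
    "('k :: field_char_0, 'g :: ab_group_add) avg_lie \<Rightarrow> ('k, 'h :: ab_group_add) avg_lie
      \<Rightarrow> ('g, 'h) triple \<Rightarrow> bool"
  where "nab_cocycle G H = (\<lambda>(\<chi>, \<psi>, \<Phi>).
    let P = oper G; Q = oper H in
      (\<forall>y. lin G H (\<lambda>x. \<chi> x y)) \<and> (\<forall>x. lin G H (\<lambda>y. \<chi> x y)) \<and> (\<forall>x. \<chi> x x = 0)
    \<and> (\<forall>x. derivation H (\<psi> x)) \<and> (\<forall>h. lin G H (\<lambda>x. \<psi> x h))
    \<and> lin G H \<Phi>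
    \<and> (\<forall>x y h. \<psi> x (\<psi> y h) - \<psi> y (\<psi> x h) - \<psi> (lie G x y) h = lie H (\<chi> x y) h)
    \<and> (\<forall>x y z. \<psi> x (\<chi> y z) + \<psi> y (\<chi> z x) + \<psi> z (\<chi> x y)
          - \<chi> (lie G x y) z - \<chi> (lie G y z) x - \<chi> (lie G z x) y = 0)
    \<and> (\<forall>x h. \<psi> (P x) (Q h) = Q (\<psi> (P x) h) + Q (lie H (\<Phi> x) h) - lie H (\<Phi> x) (Q h)
          \<and> Q (\<psi> (P x) h) + Q (lie H (\<Phi> x) h) - lie H (\<Phi> x) (Q h)
            = Q (\<psi> x (Q h)) - lie H (\<Phi> x) (Q h))
    \<and> (\<forall>x y. \<chi> (P x) (P y) - Q (\<chi> (P x) y) - \<Phi> (lie G (P x) y) + \<psi> (P x) (\<Phi> y)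
          - \<psi> (P y) (\<Phi> x) + Q (\<psi> y (\<Phi> x)) + lie H (\<Phi> x) (\<Phi> y) = 0))"

definition nab_equivalent ::
    "('k :: field_char_0, 'g :: ab_group_add) avg_lie \<Rightarrow> ('k, 'h :: ab_group_add) avg_lie
      \<Rightarrow> ('g, 'h) triple \<Rightarrow> ('g, 'h) triple \<Rightarrow> bool"
  where "nab_equivalent G H = (\<lambda>(\<chi>, \<psi>, \<Phi>) (\<chi>', \<psi>', \<Phi>').
    \<exists>\<phi>. lin G H \<phi>
    \<and> (\<forall>x h. \<psi> x h - \<psi>' x h = lie H (\<phi> x) h)
    \<and> (\<forall>x y. \<chi> x y - \<chi>' x y
          = \<psi>' x (\<phi> y) - \<psi>' y (\<phi> x) - \<phi> (lie G x y) + lie H (\<phi> x) (\<phi> y))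
    \<and> (\<forall>x. \<Phi> x - \<Phi>' x = oper H (\<phi> x) - \<phi> (oper G x)))"

definition nab_cocycles ::
    "('k :: field_char_0, 'g :: ab_group_add) avg_lie \<Rightarrow> ('k, 'h :: ab_group_add) avg_lie
      \<Rightarrow> ('g, 'h) triple set"
  where "nab_cocycles G H = {c. nab_cocycle G H c}"

definition nab_rel ::
    "('k :: field_char_0, 'g :: ab_group_add) avg_lie \<Rightarrow> ('k, 'h :: ab_group_add) avg_lie
      \<Rightarrow> (('g, 'h) triple \<times> ('g, 'h) triple) set"
  where "nab_rel G H =
    {(c, c'). c \<in> nab_cocycles G H \<and> c' \<in> nab_cocycles G H \<and> nab_equivalent G H c c'}"

definition H2_nab ::
    "('k :: field_char_0, 'g :: ab_group_add) avg_lie \<Rightarrow> ('k, 'h :: ab_group_add) avg_lie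
      \<Rightarrow> ('g, 'h) triple set set"
  where "H2_nab G H = nab_cocycles G H // nab_rel G H"

text \<open>
  The identification of \<open>\<hh>\<close> with \<open>i(\<hh>)\<close> is made explicit: values in \<open>range i\<close> are pulled
  back along the injection \<open>i\<close>.
\<close>

definition section_cocycle ::
    "('k :: field_char_0, 'e :: ab_group_add) avg_lie \<Rightarrow> ('k, 'g :: ab_group_add) avg_lie
      \<Rightarrow> ('h :: ab_group_add \<Rightarrow> 'e) \<Rightarrow> ('g \<Rightarrow> 'e) \<Rightarrow> ('g, 'h) triple"
  where "section_cocycle E G i s =
    ((\<lambda>x y. inv_into UNIV i (lie E (s x) (s y) - s (lie G x y))),
     (\<lambda>x h. inv_into UNIV i (lie E (s x) (i h))),
     (\<lambda>x. inv_into UNIV i (oper E (s x) - s (oper G x))))"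

definition Aut_sub ::
    "('k :: field_char_0, 'e :: ab_group_add) avg_lie \<Rightarrow> ('h :: ab_group_add \<Rightarrow> 'e) \<Rightarrow> ('e \<Rightarrow> 'e) monoid"
  where "Aut_sub E i = (Aut E)\<lparr>carrier := {\<gamma> \<in> carrier (Aut E). \<gamma> ` range i = range i}\<rparr>"

definition Pi_map ::
    "('h \<Rightarrow> 'e) \<Rightarrow> ('e \<Rightarrow> 'g) \<Rightarrow> ('g \<Rightarrow> 'e) \<Rightarrow> ('e \<Rightarrow> 'e) \<Rightarrow> ('h \<Rightarrow> 'h) \<times> ('g \<Rightarrow> 'g)"
  where "Pi_map i p s \<gamma> = (inv_into UNIV i \<circ> \<gamma> \<circ> i, p \<circ> \<gamma> \<circ> s)"

definition Aut_sub_fix ::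
    "('k :: field_char_0, 'e :: ab_group_add) avg_lie \<Rightarrow> ('h :: ab_group_add \<Rightarrow> 'e) \<Rightarrow> ('e \<Rightarrow> 'g)
      \<Rightarrow> ('g \<Rightarrow> 'e) \<Rightarrow> ('e \<Rightarrow> 'e) monoid"
  where "Aut_sub_fix E i p s =
    (Aut_sub E i)\<lparr>carrier := {\<gamma> \<in> carrier (Aut_sub E i). Pi_map i p s \<gamma> = (id, id)}\<rparr>"

definition transform ::
    "('h \<Rightarrow> 'h) \<times> ('g \<Rightarrow> 'g) \<Rightarrow> ('g, 'h) triple \<Rightarrow> ('g, 'h) triple"
  where "transform = (\<lambda>(\<beta>, \<alpha>) (\<chi>, \<psi>, \<Phi>).
    let \<alpha>' = inv_into UNIV \<alpha>; \<beta>' = inv_into UNIV \<beta> in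
    ((\<lambda>x y. \<beta> (\<chi> (\<alpha>' x) (\<alpha>' y))), (\<lambda>x h. \<beta> (\<psi> (\<alpha>' x) (\<beta>' h))), (\<lambda>x. \<beta> (\<Phi> (\<alpha>' x)))))"

text \<open>
  A difference of non-abelian cocycles is in general not a cocycle, and \<open>H\<^sup>2\<^sub>n\<^sub>a\<^sub>b\<close> is only a
  pointed set.  The bracket
  \<open>[(\<chi>\<^sub>(\<^sub>\<beta>\<^sub>,\<^sub>\<alpha>\<^sub>), \<psi>\<^sub>(\<^sub>\<beta>\<^sub>,\<^sub>\<alpha>\<^sub>), \<Phi>\<^sub>(\<^sub>\<beta>\<^sub>,\<^sub>\<alpha>\<^sub>)) - (\<chi>, \<psi>, \<Phi>)]\<close>
  is therefore the class of the transformed cocycle, in \<open>H\<^sup>2\<^sub>n\<^sub>a\<^sub>b\<close> pointed by the class of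
  \<open>(\<chi>, \<psi>, \<Phi>)\<close>, which plays the role of \<open>0\<close>.
\<close>

definition Wells ::
    "('k :: field_char_0, 'h :: ab_group_add) avg_lie \<Rightarrow> ('k, 'e :: ab_group_add) avg_lie
      \<Rightarrow> ('k, 'g :: ab_group_add) avg_lie \<Rightarrow> ('h \<Rightarrow> 'e) \<Rightarrow> ('g \<Rightarrow> 'e)
      \<Rightarrow> ('h \<Rightarrow> 'h) \<times> ('g \<Rightarrow> 'g) \<Rightarrow> ('g, 'h) triple set"
  where "Wells H E G i s ba = nab_rel G H `` {transform ba (section_cocycle E G i s)}"

definition Wells_zero ::
    "('k :: field_char_0, 'h :: ab_group_add) avg_lie \<Rightarrow> ('k, 'e :: ab_group_add) avg_lie
      \<Rightarrow> ('k, 'g :: ab_group_add) avg_lie \<Rightarrow> ('h \<Rightarrow> 'e) \<Rightarrow> ('g \<Rightarrow> 'e) \<Rightarrow> ('g, 'h) triple set"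
  where "Wells_zero H E G i s = nab_rel G H `` {section_cocycle E G i s}"

end

theory Submission
  imports Defs
begin

text \<open>
  Write \<open>c\<close> for the cocycle of a section \<open>s\<close>. The theorem rests on reading both sides of the
  equation \<open>W(\<beta>, \<alpha>) = 0\<close> in terms of sections.

  The triples equivalent to \<open>c\<close> are exactly the cocycles of the sections of \<open>p\<close>
  (\<open>nab_equivalent_section_cocycle_iff\<close>): any other section has the form \<open>s + i \<circ> \<phi>\<close> with \<open>\<phi>\<close> linear
  from \<open>G\<close> to \<open>H\<close>, and expanding brackets and operator at \<open>s x + i (\<phi> x)\<close> produces precisely the three
  equations that define equivalence through \<open>\<phi>\<close>. Hence \<open>W(\<beta>, \<alpha>) = 0\<close> says that some section \<open>s'\<close> has
  the \<open>(\<beta>, \<alpha>)\<close>-transform of \<open>c\<close> as its cocycle.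

  A vector of \<open>E\<close> is uniquely \<open>i h + s x\<close>, and \<open>c\<close>, together with \<open>H\<close> and \<open>G\<close>, determines the bracket and
  the operator of \<open>E\<close> in these coordinates. If \<open>\<gamma>\<close> preserves \<open>i(H)\<close> and induces \<open>(\<beta>, \<alpha>)\<close>, then applying \<open>\<gamma>\<close> to the
  defining equations of \<open>c\<close> shows that the section \<open>\<gamma> \<circ> s \<circ> \<alpha>\<^sup>-\<^sup>1\<close> has the transform of \<open>c\<close> as cocycle
  (\<open>transform_section_cocycle\<close>). Conversely, if \<open>s'\<close> is a section with that cocycle, then
  \<open>i h + s x \<mapsto> i (\<beta> h) + s' (\<alpha> x)\<close> respects bracket and operator, because its source and target carry
  matching cocycles, and it induces \<open>(\<beta>, \<alpha>)\<close> (\<open>ex_Pi_map_eq\<close>). This is exactness at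
  \<open>Aut(H) \<times> Aut(G)\<close>; exactness at the two other places holds because \<open>Aut_sub_fix\<close> is the kernel of
  \<open>\<Pi>\<close> and \<open>\<iota>\<close> is an inclusion.

  For \<open>W\<close> to have values in the second cohomology, cocycles of sections and their transforms must
  satisfy the cocycle identities. For sections these are the Jacobi identity and the averaging
  identity of \<open>E\<close>, read off in the coordinates above; a transform is itself the cocycle of a section,
  in an extension with modified \<open>i\<close> and \<open>p\<close>.
\<close>

section \<open>Linear maps and morphisms\<close>

lemma lin_add: "lin A B f \<Longrightarrow> f (x + y) = f x + f y"
  and lin_scal: "lin A B f \<Longrightarrow> f (scal A c x) = scal B c (f x)"
  by (simp_all add: Vector_Spaces.linear_iff)

lemma lin_minus: "lin A B f \<Longrightarrow> f (- x) = - f x"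
  and lin_diff: "lin A B f \<Longrightarrow> f (x - y) = f x - f y"
  and lin_zero: "lin A B f \<Longrightarrow> f 0 = 0"
  by (simp_all add: linear_iff_module_hom module_hom.neg module_hom.diff module_hom.zero)

lemmas lin_simps = lin_add lin_minus lin_diff lin_zero lin_scal

lemma linI:
  assumes "vector_space (scal A)" "vector_space (scal B)"
    and "\<And>x y. f (x + y) = f x + f y" "\<And>c x. f (scal A c x) = scal B c (f x)"
  shows "lin A B f"
  using assms by (simp add: Vector_Spaces.linear_iff)

lemma lin_vector_space:
  assumes "lin A B f"
  shows "vector_space (scal A)" "vector_space (scal B)"
  using assms by (simp_all add: Vector_Spaces.linear_iff)

lemma lin_compose: "lin A B f \<Longrightarrow> lin B C g \<Longrightarrow> lin A C (\<lambda>x. g (f x))"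
  using Vector_Spaces.linear_compose[of "scal A" "scal B" f "scal C" g] by (simp add: o_def)

lemma lin_inv:
  assumes f: "lin A B f" and "bij f"
  shows "lin B A (inv_into UNIV f)"
proof (rule linI)
  have inj: "inj f" and [simp]: "f (inv_into UNIV f y) = y" for y
    using \<open>bij f\<close> by (simp_all add: bij_is_inj bij_is_surj surj_f_inv_f)
  show "inv_into UNIV f (x + y) = inv_into UNIV f x + inv_into UNIV f y" for x y
    by (rule injD[OF inj]) (simp add: lin_add[OF f])
  show "inv_into UNIV f (scal B c x) = scal A c (inv_into UNIV f x)" for c x
    by (rule injD[OF inj]) (simp add: lin_scal[OF f])
qed (use lin_vector_space[OF f] in auto)

lemma averaging_hom_lin: "averaging_hom A B f \<Longrightarrow> lin A B f"
  and averaging_hom_lie: "averaging_hom A B f \<Longrightarrow> f (lie A x y) = lie B (f x) (f y)"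
  and averaging_hom_oper: "averaging_hom A B f \<Longrightarrow> f (oper A x) = oper B (f x)"
  by (simp_all add: averaging_hom_def)

lemma averaging_hom_compose:
  "averaging_hom A B f \<Longrightarrow> averaging_hom B C g \<Longrightarrow> averaging_hom A C (g \<circ> f)"
  unfolding averaging_hom_def
  by (intro conjI) (auto intro: Vector_Spaces.linear_compose)

lemma averaging_hom_inv:
  assumes f: "averaging_hom A B f" and "bij f"
  shows "averaging_hom B A (inv_into UNIV f)"
proof -
  have inj: "inj f" and [simp]: "f (inv_into UNIV f y) = y" for y
    using \<open>bij f\<close> by (simp_all add: bij_is_inj bij_is_surj surj_f_inv_f)
  have "inv_into UNIV f (lie B x y) = lie A (inv_into UNIV f x) (inv_into UNIV f y)" for x y
    by (rule injD[OF inj]) (simp add: averaging_hom_lie[OF f])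
  moreover have "oper A (inv_into UNIV f x) = inv_into UNIV f (oper B x)" for x
    by (rule injD[OF inj]) (simp add: averaging_hom_oper[OF f])
  ultimately show ?thesis
    using lin_inv[OF averaging_hom_lin[OF f] \<open>bij f\<close>] by (simp add: averaging_hom_def)
qed

lemma carrier_Aut: "f \<in> carrier (Aut L) \<longleftrightarrow> averaging_hom L L f \<and> bij f"
  by (simp add: Aut_def)

lemma mult_Aut [simp]: "mult (Aut L) = (\<circ>)"
  and one_Aut [simp]: "one (Aut L) = id"
  by (simp_all add: Aut_def)

lemma (in averaging_lie_algebra) group_Aut: "group (Aut L)"
proof (rule groupI)
  have "lin L L id"
    by (rule linI) (auto intro: vector_space_axioms)
  then show "\<one>\<^bsub>Aut L\<^esub> \<in> carrier (Aut L)"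
    by (simp add: carrier_Aut averaging_hom_def)
  show "\<exists>g\<in>carrier (Aut L). g \<otimes>\<^bsub>Aut L\<^esub> f = \<one>\<^bsub>Aut L\<^esub>" if "f \<in> carrier (Aut L)" for f
    using that
    by (intro bexI[of _ "inv_into UNIV f"])
       (auto simp: carrier_Aut averaging_hom_inv bij_imp_bij_inv bij_is_inj)
qed (auto simp: carrier_Aut intro: averaging_hom_compose bij_comp)

section \<open>Calculating in a Lie algebra\<close>

context lie_algebra
begin

lemmas lie_lin_simps = lin_simps[OF lie_linear_left] lin_simps[OF lie_linear_right]

lemma lie_antisym: "lie L x y = - lie L y x"
proof -
  have "lie L (x + y) (x + y) = 0"
    by (rule lie_alternating)
  then show ?thesis
    unfolding lie_lin_simps by (simp add: lie_alternating eq_neg_iff_add_eq_0 add.commute)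
qed

lemma lie_jacobi_derivation: "lie L x (lie L y z) = lie L (lie L x y) z + lie L y (lie L x z)"
proof -
  have "lie L y (lie L z x) = - lie L y (lie L x z)"
    by (subst lie_antisym) (simp add: lie_lin_simps)
  moreover have "lie L z (lie L x y) = - lie L (lie L x y) z"
    by (rule lie_antisym)
  ultimately show ?thesis
    using lie_jacobi[of x y z] by (simp add: algebra_simps)
qed

end

text \<open>
  By antisymmetry an averaging operator may also be averaged over the other argument; the second half
  of the compatibility between \<open>\<psi>\<close> and the operators is this form of the identity.
\<close>

lemma (in averaging_lie_algebra) oper_averaging_right:
  "lie L (oper L x) (oper L y) = oper L (lie L x (oper L y))"
  using oper_averaging[of y x] lie_antisym[of "oper L x" "oper L y"] lie_antisym[of x "oper L y"]
  by (simp add: lin_minus[OF oper_linear])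

section \<open>Equivalence of non-abelian cocycles\<close>

lemma nab_equivalent_refl:
  assumes "averaging_lie_algebra G" "averaging_lie_algebra H"
    and "nab_cocycle G H c"
  shows "nab_equivalent G H c c"
proof -
  interpret G: averaging_lie_algebra G by fact
  interpret H: averaging_lie_algebra H by fact
  obtain \<chi> \<psi> \<Phi> where c: "c = (\<chi>, \<psi>, \<Phi>)" by (cases c)
  have "lin H H (\<psi> x)" for x
    using assms(3) by (simp add: c nab_cocycle_def Let_def derivation_def)
  then have "\<psi> x 0 = 0" for x
    by (rule lin_zero)
  moreover have "lin G H (\<lambda>_. 0)"
    by (rule linI) (auto intro: G.vector_space_axioms H.vector_space_axioms)
  ultimately show ?thesis
    by (auto simp: c nab_equivalent_def H.lie_lin_simps lin_zero[OF H.oper_linear]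
        intro!: exI[of _ "\<lambda>_. 0"])
qed

text \<open>
  If \<open>\<phi>\<close> realises an equivalence, \<open>- \<phi>\<close> realises the reverse one: exchanging \<open>\<psi>'\<close> for \<open>\<psi>\<close> in the formula
  for the difference of the \<open>\<chi>\<close>s contributes the bracket of \<open>\<phi> x\<close> and \<open>\<phi> y\<close> twice, which turns the sign
  of the quadratic term.
\<close>

lemma nab_equivalent_sym:
  assumes "averaging_lie_algebra H"
    and c: "nab_cocycle G H c" and equivalent: "nab_equivalent G H c c'"
  shows "nab_equivalent G H c' c"
proof -
  interpret H: averaging_lie_algebra H by fact
  obtain \<chi> \<psi> \<Phi> \<chi>' \<psi>' \<Phi>' where cc': "c = (\<chi>, \<psi>, \<Phi>)" "c' = (\<chi>', \<psi>', \<Phi>')"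
    by (cases c, cases c')
  have \<psi>: "lin H H (\<psi> x)" for x
    using c by (simp add: cc' nab_cocycle_def Let_def derivation_def)
  obtain \<phi> where \<phi>: "lin G H \<phi>" and "\<forall>x h. \<psi> x h - \<psi>' x h = lie H (\<phi> x) h"
    and "\<forall>x y. \<chi> x y - \<chi>' x y = \<psi>' x (\<phi> y) - \<psi>' y (\<phi> x) - \<phi> (lie G x y) + lie H (\<phi> x) (\<phi> y)"
    and "\<forall>x. \<Phi> x - \<Phi>' x = oper H (\<phi> x) - \<phi> (oper G x)"
    using equivalent by (auto simp: cc' nab_equivalent_def)
  then have \<psi>': "\<psi>' x h = \<psi> x h - lie H (\<phi> x) h" and
    \<chi>': "\<chi> x y = \<chi>' x y + (\<psi>' x (\<phi> y) - \<psi>' y (\<phi> x) - \<phi> (lie G x y) + lie H (\<phi> x) (\<phi> y))" and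
    \<Phi>': "\<Phi> x = \<Phi>' x + (oper H (\<phi> x) - \<phi> (oper G x))" for x y h
    by (metis add.commute diff_add_cancel diff_diff_eq2 add_diff_cancel_left')+
  have "lin G H (\<lambda>x. - \<phi> x)"
    using \<phi> lin_vector_space[OF \<phi>]
    by (intro linI) (simp_all add: lin_simps[OF \<phi>] module.scale_minus_right module_iff_vector_space)
  moreover have "\<chi>' x y - \<chi> x y
      = \<psi> x (- \<phi> y) - \<psi> y (- \<phi> x) - - \<phi> (lie G x y) + lie H (- \<phi> x) (- \<phi> y)" for x y
    by (simp add: \<chi>' \<psi>' lin_minus[OF \<psi>] H.lie_lin_simps H.lie_antisym[of "\<phi> y" "\<phi> x"])
  ultimately show ?thesis
    by (auto simp: cc' nab_equivalent_def \<psi>' \<Phi>' H.lie_lin_simps lin_minus[OF H.oper_linear]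
        intro!: exI[of _ "\<lambda>x. - \<phi> x"])
qed

text \<open>
  Equivalences compose by adding the maps \<open>\<phi>\<close>. The mixed brackets in the quadratic term of the sum come
  from the passage from \<open>\<psi>'\<close> to \<open>\<psi>''\<close>.
\<close>

lemma nab_equivalent_trans:
  assumes "averaging_lie_algebra H" and c'': "nab_cocycle G H c''"
    and equivalent: "nab_equivalent G H c c'" "nab_equivalent G H c' c''"
  shows "nab_equivalent G H c c''"
proof -
  interpret H: averaging_lie_algebra H by fact
  obtain \<chi> \<psi> \<Phi> \<chi>' \<psi>' \<Phi>' \<chi>'' \<psi>'' \<Phi>''
    where cc': "c = (\<chi>, \<psi>, \<Phi>)" "c' = (\<chi>', \<psi>', \<Phi>')" "c'' = (\<chi>'', \<psi>'', \<Phi>'')"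
    by (cases c, cases c', cases c'')
  have \<psi>'': "lin H H (\<psi>'' x)" for x
    using c'' by (simp add: cc' nab_cocycle_def Let_def derivation_def)
  obtain \<phi> where \<phi>: "lin G H \<phi>" and 1: "\<forall>x h. \<psi> x h - \<psi>' x h = lie H (\<phi> x) h"
    "\<forall>x y. \<chi> x y - \<chi>' x y = \<psi>' x (\<phi> y) - \<psi>' y (\<phi> x) - \<phi> (lie G x y) + lie H (\<phi> x) (\<phi> y)"
    "\<forall>x. \<Phi> x - \<Phi>' x = oper H (\<phi> x) - \<phi> (oper G x)"
    using equivalent by (auto simp: cc' nab_equivalent_def)
  obtain \<phi>' where \<phi>': "lin G H \<phi>'" and 2: "\<forall>x h. \<psi>' x h - \<psi>'' x h = lie H (\<phi>' x) h"
    "\<forall>x y. \<chi>' x y - \<chi>'' x y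
      = \<psi>'' x (\<phi>' y) - \<psi>'' y (\<phi>' x) - \<phi>' (lie G x y) + lie H (\<phi>' x) (\<phi>' y)"
    "\<forall>x. \<Phi>' x - \<Phi>'' x = oper H (\<phi>' x) - \<phi>' (oper G x)"
    using equivalent by (auto simp: cc' nab_equivalent_def)
  have \<psi>: "\<psi> x h = \<psi>'' x h + lie H (\<phi>' x) h + lie H (\<phi> x) h"
    and \<psi>': "\<psi>' x h = \<psi>'' x h + lie H (\<phi>' x) h" for x h
    using 1(1)[rule_format, of x h] 2(1)[rule_format, of x h] by (simp_all add: algebra_simps)
  have "lin G H (\<lambda>x. \<phi> x + \<phi>' x)"
    using lin_vector_space[OF \<phi>]
    by (intro linI) (simp_all add: lin_simps[OF \<phi>] lin_simps[OF \<phi>'] algebra_simps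
        module.scale_right_distrib module_iff_vector_space)
  moreover have "\<chi> x y - \<chi>'' x y = \<psi>'' x (\<phi> y + \<phi>' y) - \<psi>'' y (\<phi> x + \<phi>' x)
      - (\<phi> (lie G x y) + \<phi>' (lie G x y)) + lie H (\<phi> x + \<phi>' x) (\<phi> y + \<phi>' y)" for x y
  proof -
    have "\<chi> x y - \<chi>'' x y = (\<chi> x y - \<chi>' x y) + (\<chi>' x y - \<chi>'' x y)"
      by simp
    then show ?thesis
      unfolding 1(2)[rule_format] 2(2)[rule_format] \<psi>'
      by (simp add: lin_add[OF \<psi>''] H.lie_lin_simps H.lie_antisym[of "\<phi>' y" "\<phi> x"] algebra_simps)
  qed
  moreover have "\<Phi> x - \<Phi>'' x = oper H (\<phi> x + \<phi>' x) - (\<phi> (oper G x) + \<phi>' (oper G x))" for x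
    using 1(3)[rule_format, of x] 2(3)[rule_format, of x]
    by (simp add: lin_add[OF H.oper_linear] algebra_simps)
  ultimately show ?thesis
    by (auto simp: cc' nab_equivalent_def \<psi> H.lie_lin_simps intro!: exI[of _ "\<lambda>x. \<phi> x + \<phi>' x"])
qed

lemma equiv_nab_rel:
  assumes "averaging_lie_algebra G" "averaging_lie_algebra H"
  shows "equiv (nab_cocycles G H) (nab_rel G H)"
proof (rule equivI)
  show "refl_on (nab_cocycles G H) (nab_rel G H)"
    using nab_equivalent_refl[OF assms] by (auto simp: refl_on_def nab_rel_def nab_cocycles_def)
  show "sym (nab_rel G H)"
    using nab_equivalent_sym[OF assms(2)] by (auto simp: sym_def nab_rel_def nab_cocycles_def)
  show "trans (nab_rel G H)"
    using nab_equivalent_trans[OF assms(2)]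
    by (fastforce simp: nab_rel_def nab_cocycles_def intro: transI)
qed (auto simp: nab_rel_def)

section \<open>Cocycles of sections\<close>

context nonabelian_extension
begin

lemmas i_simps = averaging_hom_lie[OF i_hom] averaging_hom_oper[OF i_hom]
  lin_simps[OF averaging_hom_lin[OF i_hom]]

lemmas p_simps = averaging_hom_lie[OF p_hom] averaging_hom_oper[OF p_hom]
  lin_simps[OF averaging_hom_lin[OF p_hom]]

lemma i_eq_iff [simp]: "i h = i k \<longleftrightarrow> h = k"
  using i_inj by (simp add: inj_eq)

lemma p_i [simp]: "p (i h) = 0"
  using exact by auto

lemma i_inv [simp]: "p e = 0 \<Longrightarrow> i (inv_into UNIV i e) = e"
  using exact by (simp add: f_inv_into_f)

lemma section_lin: "linear_section E G p s \<Longrightarrow> lin G E s"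
  and section_p [simp]: "linear_section E G p s \<Longrightarrow> p (s x) = x"
  by (simp_all add: linear_section_def o_def id_def fun_eq_iff)

text \<open>
  The three arguments of \<open>i\<^sup>-\<^sup>1\<close> in the definition lie in the kernel of \<open>p\<close>, that is, in \<open>i(H)\<close>. The
  resulting characterisation without \<open>i\<^sup>-\<^sup>1\<close> is the only description of the cocycle used below.
\<close>

lemma section_cocycle_iff:
  assumes s: "linear_section E G p s"
  shows "section_cocycle E G i s = (\<chi>, \<psi>, \<Phi>) \<longleftrightarrow>
    (\<forall>x y. i (\<chi> x y) = lie E (s x) (s y) - s (lie G x y)) \<and>
    (\<forall>x h. i (\<psi> x h) = lie E (s x) (i h)) \<and>
    (\<forall>x. i (\<Phi> x) = oper E (s x) - s (oper G x))"
proof -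
  have *: "inv_into UNIV i e = h \<longleftrightarrow> i h = e" if "p e = 0" for e h
    by (metis that i_inv i_eq_iff)
  show ?thesis
    using s by (auto simp: section_cocycle_def fun_eq_iff * p_simps G.lie_lin_simps)
qed

lemma section_cocycle_eqs:
  assumes "linear_section E G p s" and "section_cocycle E G i s = (\<chi>, \<psi>, \<Phi>)"
  shows "i (\<chi> x y) = lie E (s x) (s y) - s (lie G x y)"
    and "i (\<psi> x h) = lie E (s x) (i h)"
    and "i (\<Phi> x) = oper E (s x) - s (oper G x)"
  using section_cocycle_iff assms by blast+

text \<open>
  Each identity holds after applying the injection \<open>i\<close>. There it becomes an instance of the
  Jacobi identity of \<open>E\<close> (flatness of \<open>\<psi>\<close> up to \<open>\<chi>\<close>, closedness of \<open>\<chi>\<close>, and \<open>\<psi> x\<close> being a derivation) or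
  of the averaging identity (the compatibilities of \<open>\<psi>\<close> with the operators at \<open>s x\<close> and \<open>i h\<close>, the last
  equation at \<open>s x\<close> and \<open>s y\<close>).
\<close>

lemma nab_cocycle_section_cocycle:
  assumes s: "linear_section E G p s"
  shows "nab_cocycle G H (section_cocycle E G i s)"
proof -
  obtain \<chi> \<psi> \<Phi> where c: "section_cocycle E G i s = (\<chi>, \<psi>, \<Phi>)"
    by (cases "section_cocycle E G i s")
  note i_\<chi> = section_cocycle_eqs(1)[OF s c] and i_\<psi> = section_cocycle_eqs(2)[OF s c]
    and i_\<Phi> = section_cocycle_eqs(3)[OF s c]
  note i_eqD = i_eq_iff[THEN iffD1]
  note s_simps = lin_simps[OF section_lin[OF s]]
  note simps = i_simps i_\<chi> i_\<psi> i_\<Phi> s_simps E.lie_lin_simps G.lie_lin_simps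
    lin_simps[OF E.oper_linear] lin_simps[OF G.oper_linear] lin_simps[OF H.oper_linear]
    E.vector_space_axioms G.vector_space_axioms H.vector_space_axioms
    module.scale_right_diff_distrib[OF E.module_axioms]
  have "lin G H (\<lambda>x. \<chi> x y)" "lin G H (\<lambda>y. \<chi> x y)" "lin G H (\<lambda>x. \<psi> x h)" "lin G H \<Phi>" for x y h
    by (rule linI; (rule i_eqD)?; simp add: simps H.lie_lin_simps algebra_simps)+
  moreover have "\<chi> x x = 0" for x
    by (rule i_eqD) (simp add: simps E.lie_alternating G.lie_alternating)
  moreover have "derivation H (\<psi> x)" for x
  proof -
    have "lin H H (\<psi> x)"
      by (rule linI; (rule i_eqD)?; simp add: simps)
    moreover have "\<psi> x (lie H h k) = lie H (\<psi> x h) k + lie H h (\<psi> x k)" for h k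
      by (rule i_eqD) (simp add: simps, rule E.lie_jacobi_derivation)
    ultimately show ?thesis
      by (simp add: derivation_def)
  qed
  moreover have "\<psi> x (\<psi> y h) - \<psi> y (\<psi> x h) - \<psi> (lie G x y) h = lie H (\<chi> x y) h" for x y h
    by (rule i_eqD) (simp add: simps E.lie_jacobi_derivation[of "s x" "s y" "i h"])
  moreover have "\<psi> x (\<chi> y z) + \<psi> y (\<chi> z x) + \<psi> z (\<chi> x y)
      - \<chi> (lie G x y) z - \<chi> (lie G y z) x - \<chi> (lie G z x) y = 0" for x y z
  proof (rule i_eqD)
    have "s (lie G x (lie G y z)) + s (lie G y (lie G z x)) + s (lie G z (lie G x y)) = 0"
      using G.lie_jacobi[of x y z] by (simp flip: s_simps)
    then show "i (\<psi> x (\<chi> y z) + \<psi> y (\<chi> z x) + \<psi> z (\<chi> x y)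
      - \<chi> (lie G x y) z - \<chi> (lie G y z) x - \<chi> (lie G z x) y) = i 0"
      using E.lie_jacobi[of "s x" "s y" "s z"]
      by (simp add: simps E.lie_antisym[of "s (lie G _ _)"] G.lie_antisym[of "lie G _ _"] algebra_simps)
  qed
  moreover have "\<psi> (oper G x) (oper H h)
      = oper H (\<psi> (oper G x) h) + oper H (lie H (\<Phi> x) h) - lie H (\<Phi> x) (oper H h)" for x h
    by (rule i_eqD) (simp add: simps E.oper_averaging)
  moreover have "oper H (\<psi> (oper G x) h) + oper H (lie H (\<Phi> x) h) - lie H (\<Phi> x) (oper H h)
      = oper H (\<psi> x (oper H h)) - lie H (\<Phi> x) (oper H h)" for x h
    by (rule i_eqD) (simp add: simps E.oper_averaging_right flip: E.oper_averaging)
  moreover have "\<chi> (oper G x) (oper G y) - oper H (\<chi> (oper G x) y) - \<Phi> (lie G (oper G x) y)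
      + \<psi> (oper G x) (\<Phi> y) - \<psi> (oper G y) (\<Phi> x) + oper H (\<psi> y (\<Phi> x)) + lie H (\<Phi> x) (\<Phi> y) = 0"
    for x y
    by (rule i_eqD) (simp add: simps G.oper_averaging E.oper_averaging algebra_simps
        E.lie_antisym[of "s (oper G y)"] E.lie_antisym[of "s y"])
  ultimately show ?thesis
    by (simp add: c nab_cocycle_def Let_def)
qed

text \<open>
  Replacing \<open>i\<close> by \<open>i \<circ> \<beta>\<^sup>-\<^sup>1\<close> and \<open>p\<close> by \<open>\<alpha> \<circ> p\<close> turns \<open>E\<close> into another extension of \<open>G\<close> by \<open>H\<close>. Its
  cocycle along \<open>s \<circ> \<alpha>\<^sup>-\<^sup>1\<close> is the transform of the cocycle of \<open>s\<close>, so the cocycle identities of the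
  transform need no separate calculation.
\<close>

lemma nab_cocycle_transform_section_cocycle:
  assumes s: "linear_section E G p s"
    and \<beta>: "averaging_hom H H \<beta>" "bij \<beta>" and \<alpha>: "averaging_hom G G \<alpha>" "bij \<alpha>"
  shows "nab_cocycle G H (transform (\<beta>, \<alpha>) (section_cocycle E G i s))"
proof -
  obtain \<chi> \<psi> \<Phi> where c: "section_cocycle E G i s = (\<chi>, \<psi>, \<Phi>)"
    by (cases "section_cocycle E G i s")
  define \<alpha>' \<beta>' where "\<alpha>' = inv_into UNIV \<alpha>" and "\<beta>' = inv_into UNIV \<beta>"
  have \<alpha>'_hom: "averaging_hom G G \<alpha>'" and \<beta>'_hom: "averaging_hom H H \<beta>'"
    using \<alpha> \<beta> by (simp_all add: \<alpha>'_def \<beta>'_def averaging_hom_inv)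
  have [simp]: "\<alpha> (\<alpha>' x) = x" "\<beta>' (\<beta> h) = h" for x h
    using \<alpha>(2) \<beta>(2) by (simp_all add: \<alpha>'_def \<beta>'_def bij_is_inj bij_is_surj surj_f_inv_f)
  have "bij \<beta>'"
    using \<beta>(2) by (simp add: \<beta>'_def bij_imp_bij_inv)
  have "\<alpha> x = 0 \<longleftrightarrow> x = 0" for x
    using \<alpha> by (metis averaging_hom_lin lin_zero bij_is_inj injD)
  then have "range (i \<circ> \<beta>') = {e. (\<alpha> \<circ> p) e = 0}"
    using exact bij_is_surj[OF \<open>bij \<beta>'\<close>] by (simp only: image_comp[symmetric] o_apply)
  then interpret twisted: nonabelian_extension H E G "i \<circ> \<beta>'" "\<alpha> \<circ> p"
    using averaging_hom_compose[OF \<beta>'_hom i_hom] averaging_hom_compose[OF p_hom \<alpha>(1)]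
      inj_compose[OF i_inj bij_is_inj[OF \<open>bij \<beta>'\<close>]] comp_surj[OF p_surj bij_is_surj[OF \<alpha>(2)]]
    by unfold_locales
  have s': "linear_section E G (\<alpha> \<circ> p) (s \<circ> \<alpha>')"
    using lin_compose[OF averaging_hom_lin[OF \<alpha>'_hom] section_lin[OF s]] s
    unfolding linear_section_def by (simp add: fun_eq_iff comp_def)
  have "section_cocycle E G (i \<circ> \<beta>') (s \<circ> \<alpha>')
    = (\<lambda>x y. \<beta> (\<chi> (\<alpha>' x) (\<alpha>' y)), \<lambda>x h. \<beta> (\<psi> (\<alpha>' x) (\<beta>' h)), \<lambda>x. \<beta> (\<Phi> (\<alpha>' x)))"
    unfolding twisted.section_cocycle_iff[OF s']
    by (simp add: section_cocycle_eqs[OF s c] averaging_hom_lie[OF \<alpha>'_hom] averaging_hom_oper[OF \<alpha>'_hom])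
  then have "transform (\<beta>, \<alpha>) (section_cocycle E G i s) = section_cocycle E G (i \<circ> \<beta>') (s \<circ> \<alpha>')"
    by (simp add: c transform_def Let_def \<alpha>'_def \<beta>'_def)
  then show ?thesis
    using twisted.nab_cocycle_section_cocycle[OF s'] by simp
qed

text \<open>
  Two sections differ by a linear map into \<open>i(H)\<close>, and the defining equations of an equivalence are the
  equations of \<open>section_cocycle_iff\<close> for \<open>s + i \<circ> \<phi>\<close>, expanded and pulled back along \<open>i\<close>.
\<close>

lemma nab_equivalent_section_cocycle_iff:
  assumes s: "linear_section E G p s"
  shows "nab_equivalent G H c (section_cocycle E G i s) \<longleftrightarrow>
    (\<exists>s'. linear_section E G p s' \<and> section_cocycle E G i s' = c)"
proof -
  obtain \<chi> \<psi> \<Phi> where c: "c = (\<chi>, \<psi>, \<Phi>)"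
    by (cases c)
  obtain \<chi>' \<psi>' \<Phi>' where c': "section_cocycle E G i s = (\<chi>', \<psi>', \<Phi>')"
    by (cases "section_cocycle E G i s")
  note i_\<chi>' = section_cocycle_eqs(1)[OF s c'] and i_\<psi>' = section_cocycle_eqs(2)[OF s c']
    and i_\<Phi>' = section_cocycle_eqs(3)[OF s c']
  note s_simps = lin_simps[OF section_lin[OF s]]
  have key: "section_cocycle E G i s' = c \<longleftrightarrow>
      (\<forall>x h. \<psi> x h - \<psi>' x h = lie H (\<phi> x) h) \<and>
      (\<forall>x y. \<chi> x y - \<chi>' x y = \<psi>' x (\<phi> y) - \<psi>' y (\<phi> x) - \<phi> (lie G x y) + lie H (\<phi> x) (\<phi> y)) \<and>
      (\<forall>x. \<Phi> x - \<Phi>' x = oper H (\<phi> x) - \<phi> (oper G x))"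
    if s': "linear_section E G p s'" and eq: "\<And>x. s' x = s x + i (\<phi> x)" for s' \<phi>
  proof -
    have "i (\<psi> x h) = lie E (s' x) (i h) \<longleftrightarrow> \<psi> x h - \<psi>' x h = lie H (\<phi> x) h" for x h
      by (subst i_eq_iff[symmetric, of "_ - _"])
         (auto simp: eq i_simps i_\<psi>' E.lie_lin_simps algebra_simps)
    moreover have "i (\<chi> x y) = lie E (s' x) (s' y) - s' (lie G x y) \<longleftrightarrow>
      \<chi> x y - \<chi>' x y = \<psi>' x (\<phi> y) - \<psi>' y (\<phi> x) - \<phi> (lie G x y) + lie H (\<phi> x) (\<phi> y)" for x y
      by (subst i_eq_iff[symmetric, of "_ - _"])
         (auto simp: eq i_simps i_\<chi>' i_\<psi>' E.lie_lin_simps E.lie_antisym[of "i _" "s _"] algebra_simps)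
    moreover have "i (\<Phi> x) = oper E (s' x) - s' (oper G x) \<longleftrightarrow>
      \<Phi> x - \<Phi>' x = oper H (\<phi> x) - \<phi> (oper G x)" for x
      by (subst i_eq_iff[symmetric, of "_ - _"])
         (auto simp: eq i_simps i_\<Phi>' lin_simps[OF E.oper_linear] algebra_simps)
    ultimately show ?thesis
      unfolding c section_cocycle_iff[OF s'] by blast
  qed
  show ?thesis
  proof
    assume "nab_equivalent G H c (section_cocycle E G i s)"
    then obtain \<phi> where \<phi>: "lin G H \<phi>" and eqs: "\<forall>x h. \<psi> x h - \<psi>' x h = lie H (\<phi> x) h"
      "\<forall>x y. \<chi> x y - \<chi>' x y = \<psi>' x (\<phi> y) - \<psi>' y (\<phi> x) - \<phi> (lie G x y) + lie H (\<phi> x) (\<phi> y)"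
      "\<forall>x. \<Phi> x - \<Phi>' x = oper H (\<phi> x) - \<phi> (oper G x)"
      unfolding c c' nab_equivalent_def by auto
    define s' where "s' = (\<lambda>x. s x + i (\<phi> x))"
    have "lin G E s'"
      unfolding s'_def by (rule linI) (auto simp: s_simps i_simps lin_simps[OF \<phi>] algebra_simps
          G.vector_space_axioms E.vector_space_axioms E.scale_right_distrib)
    then have s': "linear_section E G p s'"
      using s by (simp add: linear_section_def s'_def fun_eq_iff p_simps)
    then show "\<exists>s'. linear_section E G p s' \<and> section_cocycle E G i s' = c"
      using key[OF s', of \<phi>] eqs by (auto simp: s'_def)
  next
    assume "\<exists>s'. linear_section E G p s' \<and> section_cocycle E G i s' = c"
    then obtain s' where s': "linear_section E G p s'" and c_s': "section_cocycle E G i s' = c"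
      by blast
    define \<phi> where "\<phi> x = inv_into UNIV i (s' x - s x)" for x
    have i_\<phi>: "i (\<phi> x) = s' x - s x" for x
      using s s' by (simp add: \<phi>_def p_simps)
    have "lin G H \<phi>"
      by (rule linI; (rule i_eq_iff[THEN iffD1])?)
        (auto simp: i_\<phi> i_simps s_simps lin_simps[OF section_lin[OF s']] G.vector_space_axioms
          H.vector_space_axioms E.scale_right_diff_distrib)
    then show "nab_equivalent G H c (section_cocycle E G i s)"
      using key[OF s', of \<phi>] c_s' by (auto simp: c c' nab_equivalent_def i_\<phi>)
  qed
qed

section \<open>The groups and the map \<Pi>\<close>

lemma carrier_Aut_sub:
  "\<gamma> \<in> carrier (Aut_sub E i) \<longleftrightarrow> averaging_hom E E \<gamma> \<and> bij \<gamma> \<and> \<gamma> ` range i = range i"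
  by (simp add: Aut_sub_def carrier_Aut)

lemma mult_Aut_sub [simp]: "mult (Aut_sub E i) = (\<circ>)"
  and one_Aut_sub [simp]: "one (Aut_sub E i) = id"
  by (simp_all add: Aut_sub_def)

lemma group_Aut_sub: "group (Aut_sub E i)"
proof (rule groupI)
  show "one (Aut_sub E i) \<in> carrier (Aut_sub E i)"
    using group.is_monoid[OF E.group_Aut, THEN monoid.one_closed] by (simp add: carrier_Aut_sub carrier_Aut)
  show "\<exists>\<delta>\<in>carrier (Aut_sub E i). mult (Aut_sub E i) \<delta> \<gamma> = one (Aut_sub E i)"
    if \<gamma>: "\<gamma> \<in> carrier (Aut_sub E i)" for \<gamma>
  proof (intro bexI)
    have "inv_into UNIV \<gamma> ` \<gamma> ` range i = range i"
      using \<gamma> by (metis carrier_Aut_sub bij_is_inj image_inv_f_f)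
    with \<gamma> show "inv_into UNIV \<gamma> \<in> carrier (Aut_sub E i)"
      by (simp add: carrier_Aut_sub averaging_hom_inv bij_imp_bij_inv)
  qed (use \<gamma> in \<open>auto simp: carrier_Aut_sub bij_is_inj\<close>)
  show "mult (Aut_sub E i) \<gamma> \<delta> \<in> carrier (Aut_sub E i)"
    if "\<gamma> \<in> carrier (Aut_sub E i)" "\<delta> \<in> carrier (Aut_sub E i)" for \<gamma> \<delta>
    using that unfolding carrier_Aut_sub mult_Aut_sub image_comp[symmetric]
    by (metis averaging_hom_compose bij_comp)
qed (auto simp: comp_assoc)

text \<open>
  The components of \<open>\<Pi> \<gamma>\<close> are the maps that make the two squares with \<open>i\<close> and with \<open>p\<close> commute. This
  determines them independently of \<open>s\<close>, and reduces all statements about \<open>\<Pi>\<close> to diagram chases.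
\<close>

lemma Pi_map_eqs:
  assumes s: "linear_section E G p s" and \<gamma>: "\<gamma> \<in> carrier (Aut_sub E i)"
    and "Pi_map i p s \<gamma> = (\<beta>, \<alpha>)"
  shows "\<gamma> (i h) = i (\<beta> h)" "p (\<gamma> e) = \<alpha> (p e)"
proof -
  have p_\<gamma>: "p (\<gamma> (i h)) = 0" for h
  proof -
    have "\<gamma> (i h) \<in> range i"
      using \<gamma> unfolding carrier_Aut_sub by blast
    then show ?thesis
      by auto
  qed
  show "\<gamma> (i h) = i (\<beta> h)"
    using assms(3) p_\<gamma> by (auto simp: Pi_map_def)
  have "e = i (inv_into UNIV i (e - s (p e))) + s (p e)"
    using s by (simp add: p_simps)
  then have "p (\<gamma> e) = p (\<gamma> (i (inv_into UNIV i (e - s (p e))) + s (p e)))"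
    by simp
  also have "\<dots> = p (\<gamma> (s (p e)))"
    using \<gamma> by (simp only: carrier_Aut_sub averaging_hom_lin lin_add[of E E \<gamma>] p_simps p_\<gamma>) simp
  also have "\<dots> = \<alpha> (p e)"
    using assms(3) by (auto simp: Pi_map_def)
  finally show "p (\<gamma> e) = \<alpha> (p e)" .
qed

lemma Pi_map_unique:
  assumes s: "linear_section E G p s"
    and "\<And>h. \<gamma> (i h) = i (\<beta> h)" "\<And>e. p (\<gamma> e) = \<alpha> (p e)"
  shows "Pi_map i p s \<gamma> = (\<beta>, \<alpha>)"
  using assms by (auto simp: Pi_map_def fun_eq_iff inv_f_f[OF i_inj])

lemma Pi_map_mem:
  assumes s: "linear_section E G p s" and \<gamma>: "\<gamma> \<in> carrier (Aut_sub E i)"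
    and Pi: "Pi_map i p s \<gamma> = (\<beta>, \<alpha>)"
  shows "\<beta> \<in> carrier (Aut H)" "\<alpha> \<in> carrier (Aut G)"
proof -
  note \<gamma>_i = Pi_map_eqs(1)[OF assms, symmetric] and p_\<gamma> = Pi_map_eqs(2)[OF assms, symmetric]
  have \<gamma>_hom: "averaging_hom E E \<gamma>" and "bij \<gamma>" and range: "\<gamma> ` range i = range i"
    using \<gamma> by (simp_all add: carrier_Aut_sub)
  have \<gamma>_eq_iff: "\<gamma> e = \<gamma> f \<longleftrightarrow> e = f" for e f
    using \<open>bij \<gamma>\<close> by (simp add: bij_is_inj inj_eq)
  note \<gamma>_simps = averaging_hom_lie[OF \<gamma>_hom, symmetric] averaging_hom_oper[OF \<gamma>_hom, symmetric]
    lin_simps[OF averaging_hom_lin[OF \<gamma>_hom], symmetric]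
  show "\<beta> \<in> carrier (Aut H)"
    unfolding carrier_Aut averaging_hom_def
  proof (intro conjI allI)
    show "lin H H \<beta>"
      by (rule linI; (rule i_eq_iff[THEN iffD1])?)
         (simp_all add: \<gamma>_i i_simps \<gamma>_simps H.vector_space_axioms)
    show "\<beta> (lie H h k) = lie H (\<beta> h) (\<beta> k)" for h k
      by (rule i_eq_iff[THEN iffD1]) (simp add: \<gamma>_i i_simps \<gamma>_simps)
    show "oper H (\<beta> h) = \<beta> (oper H h)" for h
      by (rule i_eq_iff[THEN iffD1]) (simp add: \<gamma>_i i_simps \<gamma>_simps)
    have "inj \<beta>"
      by (rule injI, subst (asm) i_eq_iff[symmetric]) (simp add: \<gamma>_i \<gamma>_eq_iff)
    moreover have "\<exists>h. k = \<beta> h" for k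
    proof -
      have "i k \<in> \<gamma> ` range i"
        using range by blast
      then obtain h where "i k = \<gamma> (i h)"
        by blast
      then show ?thesis
        using Pi_map_eqs(1)[OF assms] by auto
    qed
    ultimately show "bij \<beta>"
      by (auto simp: bij_def surj_def)
  qed
  have p_cases: "\<exists>e. x = p e" for x
    using p_surj by (auto simp: surj_def)
  show "\<alpha> \<in> carrier (Aut G)"
    unfolding carrier_Aut averaging_hom_def
  proof (intro conjI allI)
    have "\<alpha> (x + y) = \<alpha> x + \<alpha> y" for x y
      using p_cases[of x] p_cases[of y] by (auto simp: p_\<gamma> \<gamma>_simps simp flip: p_simps)
    moreover have "\<alpha> (scal G c x) = scal G c (\<alpha> x)" for x c
      using p_cases[of x] by (auto simp: p_\<gamma> \<gamma>_simps simp flip: p_simps)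
    ultimately show \<alpha>_lin: "lin G G \<alpha>"
      by (intro linI) (simp_all add: G.vector_space_axioms)
    show "\<alpha> (lie G x y) = lie G (\<alpha> x) (\<alpha> y)" for x y
      using p_cases[of x] p_cases[of y] by (auto simp: p_\<gamma> \<gamma>_simps simp flip: p_simps)
    show "oper G (\<alpha> x) = \<alpha> (oper G x)" for x
      using p_cases[of x] by (auto simp: p_\<gamma> \<gamma>_simps simp flip: p_simps)
    have "x = 0" if "\<alpha> x = 0" for x
    proof -
      obtain e where e: "x = p e"
        using p_cases by blast
      then have "\<gamma> e \<in> range i"
        using that exact by (auto simp: p_\<gamma>)
      then have "e \<in> range i"
        using range \<gamma>_eq_iff by (metis imageE)
      then show ?thesis
        using e by auto
    qed
    then have "inj \<alpha>"
      by (metis injI eq_iff_diff_eq_0 lin_diff[OF \<alpha>_lin])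
    moreover have "\<exists>x. y = \<alpha> x" for y
    proof -
      obtain f where "y = p f"
        using p_cases by blast
      moreover obtain e where "f = \<gamma> e"
        using \<open>bij \<gamma>\<close> by (meson bij_pointE)
      ultimately show ?thesis
        by (auto simp flip: p_\<gamma>)
    qed
    ultimately show "bij \<alpha>"
      by (auto simp: bij_def surj_def)
  qed
qed

lemma group_hom_Pi_map:
  assumes s: "linear_section E G p s"
  shows "group_hom (Aut_sub E i) (Aut H \<times>\<times> Aut G) (Pi_map i p s)"
proof -
  have "Pi_map i p s (\<gamma> \<circ> \<delta>) = (\<beta> \<circ> \<beta>', \<alpha> \<circ> \<alpha>')"
    if "\<gamma> \<in> carrier (Aut_sub E i)" "Pi_map i p s \<gamma> = (\<beta>, \<alpha>)"
      "\<delta> \<in> carrier (Aut_sub E i)" "Pi_map i p s \<delta> = (\<beta>', \<alpha>')" for \<gamma> \<delta> \<beta> \<beta>' \<alpha> \<alpha>'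
    using that by (intro Pi_map_unique[OF s]) (simp_all add: Pi_map_eqs[OF s])
  moreover have "Pi_map i p s \<gamma> \<in> carrier (Aut H \<times>\<times> Aut G)" if "\<gamma> \<in> carrier (Aut_sub E i)" for \<gamma>
    using Pi_map_mem[OF s that, OF surjective_pairing] by (simp add: mem_Times_iff)
  ultimately have "Pi_map i p s \<in> hom (Aut_sub E i) (Aut H \<times>\<times> Aut G)"
    by (intro homI) (auto simp: mult_DirProd' split: prod.splits)
  then show ?thesis
    by (simp add: group_hom_def group_hom_axioms_def group_Aut_sub DirProd_group
        H.group_Aut G.group_Aut)
qed

lemma Aut_sub_fix_eq_kernel:
  "Aut_sub_fix E i p s =
    (Aut_sub E i)\<lparr>carrier := kernel (Aut_sub E i) (Aut H \<times>\<times> Aut G) (Pi_map i p s)\<rparr>"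
  by (simp add: Aut_sub_fix_def kernel_def DirProd_def)

section \<open>Lifting pairs of automorphisms\<close>

text \<open>
  The equations for the cocycle of \<open>\<gamma> \<circ> s \<circ> \<alpha>\<^sup>-\<^sup>1\<close> are the images under \<open>\<gamma>\<close> of those for \<open>s\<close>: on \<open>i(H)\<close>, \<open>\<gamma>\<close>
  acts as \<open>\<beta>\<close>, and \<open>\<alpha>\<^sup>-\<^sup>1\<close> commutes with bracket and operator.
\<close>

lemma transform_section_cocycle:
  assumes s: "linear_section E G p s" and \<gamma>: "\<gamma> \<in> carrier (Aut_sub E i)"
    and Pi: "Pi_map i p s \<gamma> = (\<beta>, \<alpha>)"
  defines "s' \<equiv> \<gamma> \<circ> s \<circ> inv_into UNIV \<alpha>"
  shows "linear_section E G p s'"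
    and "section_cocycle E G i s' = transform (\<beta>, \<alpha>) (section_cocycle E G i s)"
proof -
  obtain \<chi> \<psi> \<Phi> where c: "section_cocycle E G i s = (\<chi>, \<psi>, \<Phi>)"
    by (cases "section_cocycle E G i s")
  define \<alpha>' \<beta>' where "\<alpha>' = inv_into UNIV \<alpha>" and "\<beta>' = inv_into UNIV \<beta>"
  have \<beta>: "averaging_hom H H \<beta>" "bij \<beta>" and \<alpha>: "averaging_hom G G \<alpha>" "bij \<alpha>"
    using Pi_map_mem[OF s \<gamma> Pi] by (simp_all add: carrier_Aut)
  have \<gamma>_hom: "averaging_hom E E \<gamma>"
    using \<gamma> by (simp add: carrier_Aut_sub)
  have \<alpha>'_hom: "averaging_hom G G \<alpha>'"
    using \<alpha> by (simp add: \<alpha>'_def averaging_hom_inv)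
  have [simp]: "\<alpha> (\<alpha>' x) = x" "\<beta> (\<beta>' h) = h" for x h
    using \<alpha>(2) \<beta>(2) by (simp_all add: \<alpha>'_def \<beta>'_def bij_is_surj surj_f_inv_f)
  have s'_eq: "s' x = \<gamma> (s (\<alpha>' x))" for x
    by (simp add: s'_def \<alpha>'_def)
  show s': "linear_section E G p s'"
    using lin_compose[OF lin_compose[OF averaging_hom_lin[OF \<alpha>'_hom] section_lin[OF s]]
        averaging_hom_lin[OF \<gamma>_hom]] s
    by (simp add: linear_section_def s'_eq[abs_def] fun_eq_iff Pi_map_eqs(2)[OF s \<gamma> Pi])
  note simps = s'_eq Pi_map_eqs(1)[OF s \<gamma> Pi, symmetric] section_cocycle_eqs[OF s c]
    averaging_hom_lie[OF \<gamma>_hom] averaging_hom_oper[OF \<gamma>_hom] lin_diff[OF averaging_hom_lin[OF \<gamma>_hom]]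
    averaging_hom_lie[OF \<alpha>'_hom] averaging_hom_oper[OF \<alpha>'_hom]
  have "\<gamma> (i (\<beta>' h)) = i h" for h
    by (simp add: Pi_map_eqs(1)[OF s \<gamma> Pi])
  then have "section_cocycle E G i s' =
    (\<lambda>x y. \<beta> (\<chi> (\<alpha>' x) (\<alpha>' y)), \<lambda>x h. \<beta> (\<psi> (\<alpha>' x) (\<beta>' h)), \<lambda>x. \<beta> (\<Phi> (\<alpha>' x)))"
    unfolding section_cocycle_iff[OF s'] by (simp add: simps)
  then show "section_cocycle E G i s' = transform (\<beta>, \<alpha>) (section_cocycle E G i s)"
    by (simp add: c transform_def Let_def \<alpha>'_def \<beta>'_def)
qed

text \<open>
  In the coordinates \<open>i h + s x\<close> on the source and \<open>i k + s' y\<close> on the target, the map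
  \<open>(h, x) \<mapsto> (\<beta> h, \<alpha> x)\<close> is an automorphism as soon as the structure constants match, which is what the
  hypothesis on the two cocycles says.
\<close>

lemma ex_Pi_map_eq:
  assumes s: "linear_section E G p s" and s': "linear_section E G p s'"
    and \<beta>: "averaging_hom H H \<beta>" "bij \<beta>" and \<alpha>: "averaging_hom G G \<alpha>" "bij \<alpha>"
    and transform: "section_cocycle E G i s' = transform (\<beta>, \<alpha>) (section_cocycle E G i s)"
  shows "\<exists>\<gamma>\<in>carrier (Aut_sub E i). Pi_map i p s \<gamma> = (\<beta>, \<alpha>)"
proof
  obtain \<chi> \<psi> \<Phi> where c: "section_cocycle E G i s = (\<chi>, \<psi>, \<Phi>)"
    by (cases "section_cocycle E G i s")
  obtain \<chi>' \<psi>' \<Phi>' where c': "section_cocycle E G i s' = (\<chi>', \<psi>', \<Phi>')"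
    by (cases "section_cocycle E G i s'")
  have [simp]: "inv_into UNIV \<alpha> (\<alpha> x) = x" "inv_into UNIV \<beta> (\<beta> h) = h" for x h
    using \<alpha>(2) \<beta>(2) by (simp_all add: bij_is_inj)
  have transform_eqs:
    "\<chi>' (\<alpha> x) (\<alpha> y) = \<beta> (\<chi> x y)" "\<psi>' (\<alpha> x) (\<beta> h) = \<beta> (\<psi> x h)" "\<Phi>' (\<alpha> x) = \<beta> (\<Phi> x)" for x y h
    using transform by (simp_all add: c c' transform_def Let_def)
  have s_\<chi>: "lie E (s x) (s y) = i (\<chi> x y) + s (lie G x y)"
    and s_\<psi>: "lie E (s x) (i h) = i (\<psi> x h)" "lie E (i h) (s x) = - i (\<psi> x h)"
    and s_\<Phi>: "oper E (s x) = i (\<Phi> x) + s (oper G x)" for x y h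
    using E.lie_antisym[of "i h" "s x"] by (simp_all add: section_cocycle_eqs[OF s c])
  have s'_\<chi>: "lie E (s' (\<alpha> x)) (s' (\<alpha> y)) = i (\<beta> (\<chi> x y)) + s' (lie G (\<alpha> x) (\<alpha> y))"
    and s'_\<psi>: "lie E (s' (\<alpha> x)) (i (\<beta> h)) = i (\<beta> (\<psi> x h))"
      "lie E (i (\<beta> h)) (s' (\<alpha> x)) = - i (\<beta> (\<psi> x h))"
    and s'_\<Phi>: "oper E (s' (\<alpha> x)) = i (\<beta> (\<Phi> x)) + s' (oper G (\<alpha> x))" for x y h
    using E.lie_antisym[of "i (\<beta> h)" "s' (\<alpha> x)"]
    by (simp_all add: section_cocycle_eqs[OF s' c'] flip: transform_eqs)
  \<comment> \<open>\<open>\<kappa> e\<close> is the \<open>H\<close>-coordinate of \<open>e\<close>; the \<open>G\<close>-coordinate is \<open>p e\<close>.\<close>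
  define \<kappa> where "\<kappa> e = inv_into UNIV i (e - s (p e))" for e
  have i_\<kappa>: "i (\<kappa> e) = e - s (p e)" for e
    using s by (simp add: \<kappa>_def p_simps)
  have decompose: "e = i (\<kappa> e) + s (p e)" for e
    by (simp add: i_\<kappa>)
  have \<kappa>_eqs [simp]: "\<kappa> (i h + s x) = h" for h x
    using s by (intro i_eq_iff[THEN iffD1]) (simp add: i_\<kappa> p_simps)
  define \<gamma> where "\<gamma> e = i (\<beta> (\<kappa> e)) + s' (\<alpha> (p e))" for e
  have \<gamma>_eq: "\<gamma> (i h + s x) = i (\<beta> h) + s' (\<alpha> x)" for h x
    using s by (simp add: \<gamma>_def p_simps)
  note \<beta>_simps = averaging_hom_lie[OF \<beta>(1)] averaging_hom_oper[OF \<beta>(1)]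
    lin_simps[OF averaging_hom_lin[OF \<beta>(1)]]
  note \<alpha>_simps = averaging_hom_lie[OF \<alpha>(1)] averaging_hom_oper[OF \<alpha>(1)]
    lin_simps[OF averaging_hom_lin[OF \<alpha>(1)]]
  note s_simps = lin_simps[OF section_lin[OF s]] and s'_simps = lin_simps[OF section_lin[OF s']]
  have \<kappa>_lin: "lin E H \<kappa>"
    by (rule linI; (rule i_eq_iff[THEN iffD1])?)
      (auto simp: i_\<kappa> i_simps p_simps s_simps E.scale_right_diff_distrib
        E.vector_space_axioms H.vector_space_axioms)
  have \<gamma>_lin: "lin E E \<gamma>"
    unfolding \<gamma>_def[abs_def]
    by (rule linI) (auto simp: lin_simps[OF \<kappa>_lin] i_simps p_simps \<beta>_simps \<alpha>_simps s'_simps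
        E.scale_right_distrib E.vector_space_axioms)
  have \<gamma>_i: "\<gamma> (i h) = i (\<beta> h)" for h
    using \<gamma>_eq[of h 0] by (simp add: s_simps s'_simps \<alpha>_simps)
  have p_\<gamma>: "p (\<gamma> e) = \<alpha> (p e)" for e
    using s' by (simp add: \<gamma>_def p_simps)
  have \<gamma>_lie: "\<gamma> (lie E e f) = lie E (\<gamma> e) (\<gamma> f)" for e f
  proof -
    define h k x y where "h = \<kappa> e" and "k = \<kappa> f" and "x = p e" and "y = p f"
    have e: "e = i h + s x" and f: "f = i k + s y"
      using decompose by (simp_all add: h_def k_def x_def y_def)
    have "lie E e f = i (lie H h k + \<psi> x k - \<psi> y h + \<chi> x y) + s (lie G x y)"
      by (simp add: e f E.lie_lin_simps s_\<chi> s_\<psi> i_simps)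
    then have "\<gamma> (lie E e f) = i (\<beta> (lie H h k + \<psi> x k - \<psi> y h + \<chi> x y)) + s' (\<alpha> (lie G x y))"
      by (simp only: \<gamma>_eq)
    also have "\<dots> = lie E (i (\<beta> h) + s' (\<alpha> x)) (i (\<beta> k) + s' (\<alpha> y))"
      by (simp add: E.lie_lin_simps s'_\<chi> s'_\<psi> i_simps \<beta>_simps \<alpha>_simps)
    finally show ?thesis
      by (simp add: e f \<gamma>_eq)
  qed
  have \<gamma>_oper: "oper E (\<gamma> e) = \<gamma> (oper E e)" for e
  proof -
    define h x where "h = \<kappa> e" and "x = p e"
    have e: "e = i h + s x"
      using decompose by (simp add: h_def x_def)
    have "oper E e = i (oper H h + \<Phi> x) + s (oper G x)"
      by (simp add: e lin_simps[OF E.oper_linear] s_\<Phi> i_simps)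
    then have "\<gamma> (oper E e) = i (\<beta> (oper H h + \<Phi> x)) + s' (\<alpha> (oper G x))"
      by (simp only: \<gamma>_eq)
    also have "\<dots> = oper E (i (\<beta> h) + s' (\<alpha> x))"
      by (simp add: lin_simps[OF E.oper_linear] s'_\<Phi> i_simps \<beta>_simps \<alpha>_simps)
    finally show ?thesis
      by (simp add: e \<gamma>_eq)
  qed
  have "e = 0" if "\<gamma> e = 0" for e
  proof -
    have "\<alpha> (p e) = \<alpha> 0"
      using that p_\<gamma>[of e] by (simp add: p_simps \<alpha>_simps)
    then have "p e = 0"
      using \<alpha>(2) by (meson bij_is_inj injD)
    moreover from this have "\<beta> (\<kappa> e) = \<beta> 0"
      using that by (simp add: \<gamma>_def \<alpha>_simps s'_simps \<beta>_simps flip: i_simps(6))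
    then have "\<kappa> e = 0"
      using \<beta>(2) by (meson bij_is_inj injD)
    ultimately show ?thesis
      using decompose[of e] by (simp add: i_simps s_simps)
  qed
  then have "inj \<gamma>"
    by (metis injI eq_iff_diff_eq_0 lin_diff[OF \<gamma>_lin])
  moreover have "\<exists>e. f = \<gamma> e" for f
  proof -
    obtain x where x: "p f = \<alpha> x"
      using \<alpha>(2) by (meson bij_pointE)
    obtain h where h: "inv_into UNIV i (f - s' (p f)) = \<beta> h"
      using \<beta>(2) by (meson bij_pointE)
    have "i (\<beta> h) = f - s' (p f)"
      unfolding h[symmetric] using s' by (simp add: p_simps)
    then have "f = \<gamma> (i h + s x)"
      by (simp add: \<gamma>_eq x)
    then show ?thesis ..
  qed
  ultimately have "bij \<gamma>"
    by (auto simp: bij_def surj_def)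
  moreover have "\<gamma> ` range i = range i"
    using \<beta>(2) \<gamma>_i by (auto simp: image_comp o_def) (metis bij_pointE rangeI)
  ultimately show "\<gamma> \<in> carrier (Aut_sub E i)"
    using \<gamma>_lin \<gamma>_lie \<gamma>_oper by (simp add: carrier_Aut_sub averaging_hom_def)
  show "Pi_map i p s \<gamma> = (\<beta>, \<alpha>)"
    using \<gamma>_i p_\<gamma> by (rule Pi_map_unique[OF s])
qed

lemma image_Pi_map:
  assumes s: "linear_section E G p s"
  shows "Pi_map i p s ` carrier (Aut_sub E i) = {ba \<in> carrier (Aut H \<times>\<times> Aut G).
    nab_equivalent G H (transform ba (section_cocycle E G i s)) (section_cocycle E G i s)}"
proof (intro equalityI subsetI)
  fix ba assume "ba \<in> Pi_map i p s ` carrier (Aut_sub E i)"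
  then obtain \<gamma> where \<gamma>: "\<gamma> \<in> carrier (Aut_sub E i)" and "ba = Pi_map i p s \<gamma>"
    by blast
  moreover obtain \<beta> \<alpha> where ba: "ba = (\<beta>, \<alpha>)"
    by (cases ba)
  ultimately have Pi: "Pi_map i p s \<gamma> = (\<beta>, \<alpha>)"
    by simp
  show "ba \<in> {ba \<in> carrier (Aut H \<times>\<times> Aut G).
    nab_equivalent G H (transform ba (section_cocycle E G i s)) (section_cocycle E G i s)}"
    using Pi_map_mem[OF s \<gamma> Pi] transform_section_cocycle[OF s \<gamma> Pi]
    by (auto simp: ba nab_equivalent_section_cocycle_iff[OF s])
next
  fix ba assume "ba \<in> {ba \<in> carrier (Aut H \<times>\<times> Aut G).
    nab_equivalent G H (transform ba (section_cocycle E G i s)) (section_cocycle E G i s)}"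
  moreover obtain \<beta> \<alpha> where ba: "ba = (\<beta>, \<alpha>)"
    by (cases ba)
  ultimately show "ba \<in> Pi_map i p s ` carrier (Aut_sub E i)"
    using ex_Pi_map_eq[OF s, of _ \<beta> \<alpha>]
    by (auto simp: carrier_Aut nab_equivalent_section_cocycle_iff[OF s]) (metis image_eqI)
qed

lemma ex_linear_section: "\<exists>s. linear_section E G p s"
proof -
  interpret vector_space_pair "scal E" "scal G" ..
  show ?thesis
    using linear_surjective_right_inverse[OF averaging_hom_lin[OF p_hom] p_surj]
    by (simp add: linear_section_def)
qed

lemma Wells_sequence_facts:
  assumes s: "linear_section E G p s"
  shows "group_hom (Aut_sub_fix E i p s) (Aut_sub E i) (\<lambda>\<gamma>. \<gamma>)"
    and "Wells_zero H E G i s \<in> H2_nab G H"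
    and "Wells H E G i s \<in> carrier (Aut H \<times>\<times> Aut G) \<rightarrow> H2_nab G H"
    and "ba \<in> carrier (Aut H \<times>\<times> Aut G) \<Longrightarrow> Wells H E G i s ba = Wells_zero H E G i s \<longleftrightarrow>
      nab_equivalent G H (transform ba (section_cocycle E G i s)) (section_cocycle E G i s)"
    and "kernel (Aut_sub_fix E i p s) (Aut_sub E i) (\<lambda>\<gamma>. \<gamma>) = {one (Aut_sub_fix E i p s)}"
    and "kernel (Aut_sub E i) (Aut H \<times>\<times> Aut G) (Pi_map i p s) = carrier (Aut_sub_fix E i p s)"
proof -
  let ?c = "section_cocycle E G i s"
  have equiv: "equiv (nab_cocycles G H) (nab_rel G H)"
    by (rule equiv_nab_rel) unfold_locales
  have c: "?c \<in> nab_cocycles G H"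
    by (simp add: nab_cocycles_def nab_cocycle_section_cocycle[OF s])
  have transform_c: "transform ba ?c \<in> nab_cocycles G H" if "ba \<in> carrier (Aut H \<times>\<times> Aut G)" for ba
    using that nab_cocycle_transform_section_cocycle[OF s]
    by (auto simp: nab_cocycles_def carrier_Aut)
  show "Wells_zero H E G i s \<in> H2_nab G H"
    using c by (simp add: Wells_zero_def H2_nab_def quotientI)
  show "Wells H E G i s \<in> carrier (Aut H \<times>\<times> Aut G) \<rightarrow> H2_nab G H"
    using transform_c by (auto simp: Wells_def H2_nab_def quotientI)
  show "Wells H E G i s ba = Wells_zero H E G i s \<longleftrightarrow> nab_equivalent G H (transform ba ?c) ?c"
    if "ba \<in> carrier (Aut H \<times>\<times> Aut G)"
    using eq_equiv_class_iff[OF equiv transform_c[OF that] c] c transform_c[OF that]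
    by (auto simp: Wells_def Wells_zero_def nab_rel_def)
  interpret Pi: group_hom "Aut_sub E i" "Aut H \<times>\<times> Aut G" "Pi_map i p s"
    by (rule group_hom_Pi_map[OF s])
  show ker: "kernel (Aut_sub E i) (Aut H \<times>\<times> Aut G) (Pi_map i p s) = carrier (Aut_sub_fix E i p s)"
    by (simp add: Aut_sub_fix_eq_kernel)
  have fix_group: "group (Aut_sub_fix E i p s)"
    unfolding Aut_sub_fix_eq_kernel
    using Pi.subgroup_kernel group_Aut_sub by (rule subgroup.subgroup_is_group)
  then show "group_hom (Aut_sub_fix E i p s) (Aut_sub E i) (\<lambda>\<gamma>. \<gamma>)"
    by (auto simp: group_hom_def group_hom_axioms_def group_Aut_sub hom_def Aut_sub_fix_def)
  show "kernel (Aut_sub_fix E i p s) (Aut_sub E i) (\<lambda>\<gamma>. \<gamma>) = {one (Aut_sub_fix E i p s)}"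
    using group.is_monoid[OF fix_group, THEN monoid.one_closed]
    by (auto simp: kernel_def Aut_sub_fix_def)
qed

end

theorem theorem5p6:
  fixes H :: "('k :: field_char_0, 'h :: ab_group_add) avg_lie"
    and E :: "('k, 'e :: ab_group_add) avg_lie"
    and G :: "('k, 'g :: ab_group_add) avg_lie"
    and i :: "'h \<Rightarrow> 'e" and p :: "'e \<Rightarrow> 'g"
  assumes "nonabelian_extension H E G i p"
  shows "(\<exists>s. linear_section E G p s) \<and>
    (\<forall>s. linear_section E G p s \<longrightarrow>
        group_hom (Aut_sub_fix E i p s) (Aut_sub E i) (\<lambda>\<gamma>. \<gamma>)
      \<and> group_hom (Aut_sub E i) (Aut H \<times>\<times> Aut G) (Pi_map i p s)
      \<and> equiv (nab_cocycles G H) (nab_rel G H)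
      \<and> Wells_zero H E G i s \<in> H2_nab G H
      \<and> Wells H E G i s \<in> carrier (Aut H \<times>\<times> Aut G) \<rightarrow> H2_nab G H
      \<and> (\<forall>ba \<in> carrier (Aut H \<times>\<times> Aut G). Wells H E G i s ba = Wells_zero H E G i s \<longleftrightarrow>
            nab_equivalent G H (transform ba (section_cocycle E G i s)) (section_cocycle E G i s))
      \<and> kernel (Aut_sub_fix E i p s) (Aut_sub E i) (\<lambda>\<gamma>. \<gamma>) = {\<one>\<^bsub>Aut_sub_fix E i p s\<^esub>}
      \<and> kernel (Aut_sub E i) (Aut H \<times>\<times> Aut G) (Pi_map i p s)
          = (\<lambda>\<gamma>. \<gamma>) ` carrier (Aut_sub_fix E i p s)
      \<and> Pi_map i p s ` carrier (Aut_sub E i)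
          = {ba \<in> carrier (Aut H \<times>\<times> Aut G). Wells H E G i s ba = Wells_zero H E G i s})"
proof -
  interpret nonabelian_extension H E G i p by fact
  have "equiv (nab_cocycles G H) (nab_rel G H)"
    by (rule equiv_nab_rel) unfold_locales
  moreover have "Pi_map i p s ` carrier (Aut_sub E i)
      = {ba \<in> carrier (Aut H \<times>\<times> Aut G). Wells H E G i s ba = Wells_zero H E G i s}"
    if "linear_section E G p s" for s
    unfolding image_Pi_map[OF that] using Wells_sequence_facts(4)[OF that] by blast
  ultimately show ?thesis
    by (intro conjI allI impI ballI ex_linear_section Wells_sequence_facts group_hom_Pi_map)
      (simp_all add: Wells_sequence_facts)
qed

end
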